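(* Let $X$ be a set. The composite $\supseteq\circ\leq$ of reverse inclusion with the Mitsch order is the universal relation $\mathcal{B}_X\times\mathcal{B}_X$ on $\mathcal{B}_X$, and it is the join of $\supseteq$ and $\leq$ in the lattice of preorders on $\mathcal{B}_X$.
   Context: $\mathcal{B}_X$ is the semigroup of all binary relations on $X$ (subsets of $X\times X$) under composition, written as juxtaposition: $(x,y)\in\alpha\beta$ iff there is $z\in X$ with $(x,z)\in\alpha$ and $(z,y)\in\beta$. The Mitsch order (natural partial order) $\leq$ on any semigroup $S$ is defined by: $a\leq b$ iff $a=b$ or there are $x,y\in S$ such that $a=ax=bx=yb$; here $S=\mathcal{B}_X$. For relations $\rho,\sigma$ on the set $\mathcal{B}_X$, the composite $\rho\circ\sigma$ relates $\alpha$ to $\beta$ iff there is $\gamma\in\mathcal{B}_X$ with $\alpha\,\rho\,\gamma$ and $\gamma\,\sigma\,\beta$; thus $\alpha\,(\supseteq\circ\leq)\,\beta$ iff $\alpha\supseteq\gamma\leq\beta$ for some $\gamma$. A preorder is a reflexive transitive relation; the preorders on $\mathcal{B}_X$, ordered by containment, form a lattice, in which the join of two preorders is the least preorder containing both. *)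

theory Defs
  imports "HOL-Algebra.Lattice"
begin

definition binrels :: "'a set \<Rightarrow> 'a rel set" where
  "binrels X = Pow (X \<times> X)"

definition mitsch_order :: "'s set \<Rightarrow> ('s \<Rightarrow> 's \<Rightarrow> 's) \<Rightarrow> 's rel" where
  "mitsch_order S f =
    {(a, b). a \<in> S \<and> b \<in> S \<and>
       (a = b \<or> (\<exists>x\<in>S. \<exists>y\<in>S. a = f a x \<and> a = f b x \<and> a = f y b))}"

text \<open>
  The library's relational composition \<open>(O)\<close> composes from left to right.  It therefore serves
  both as the product of the semigroup \<open>binrels X\<close> and as the composition of relations on
  that semigroup.
\<close>

definition binrel_mitsch :: "'a set \<Rightarrow> 'a rel rel" where
  "binrel_mitsch X = mitsch_order (binrels X) (O)"

definition binrel_supset :: "'a set \<Rightarrow> 'a rel rel" where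
  "binrel_supset X = {(\<alpha>, \<beta>). \<alpha> \<in> binrels X \<and> \<beta> \<in> binrels X \<and> \<alpha> \<supseteq> \<beta>}"

definition preorder_lattice :: "'b set \<Rightarrow> 'b rel gorder" where
  "preorder_lattice A = \<lparr>carrier = {r. preorder_on A r}, eq = (=), le = (\<subseteq>)\<rparr>"

lemma lattice_preorder_lattice: "lattice (preorder_lattice A)"
proof -
  let ?L = "preorder_lattice A"
  have carrier_iff: "r \<in> carrier ?L \<longleftrightarrow> r \<subseteq> A \<times> A \<and> refl_on A r \<and> trans r" for r
    by (auto simp: preorder_lattice_def preorder_on_def)
  have le_eq: "le ?L = (\<subseteq>)" and eq_eq: "eq ?L = (=)"
    by (simp_all add: preorder_lattice_def)
  interpret partial_order ?L
    by unfold_locales (auto simp: le_eq eq_eq)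
  show ?thesis
  proof
    fix r s assume r: "r \<in> carrier ?L" and s: "s \<in> carrier ?L"
    let ?P = "{t \<in> carrier ?L. r \<subseteq> t \<and> s \<subseteq> t}"
    have "A \<times> A \<in> carrier ?L"
      by (auto simp: carrier_iff refl_on_def trans_def)
    then have top: "A \<times> A \<in> ?P"
      using r s by (simp add: carrier_iff)
    then have "\<Inter>?P \<subseteq> A \<times> A"
      by (rule Inter_lower)
    moreover have "refl_on A (\<Inter>?P)"
      by (auto simp: carrier_iff refl_on_def)
    moreover have "trans (\<Inter>?P)"
      unfolding trans_def carrier_iff by blast
    ultimately have "\<Inter>?P \<in> carrier ?L"
      by (simp add: carrier_iff)
    then have "least ?L (\<Inter>?P) (Upper ?L {r, s})"
      using r s by (auto simp: least_def Upper_def le_eq)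
    then show "\<exists>u. least ?L u (Upper ?L {r, s})" ..
    have "r \<inter> s \<in> carrier ?L"
      using r s unfolding carrier_iff trans_def refl_on_def by blast
    then have "greatest ?L (r \<inter> s) (Lower ?L {r, s})"
      using r s by (auto simp: greatest_def Lower_def le_eq)
    then show "\<exists>l. greatest ?L l (Lower ?L {r, s})" ..
  qed
qed

lemma preorder_on_binrel_supset: "preorder_on (binrels X) (binrel_supset X)"
  by (auto simp: preorder_on_def refl_on_def trans_def binrel_supset_def)

lemma preorder_on_mitsch_order:
  assumes closed: "\<And>x y. x \<in> S \<Longrightarrow> y \<in> S \<Longrightarrow> f x y \<in> S"
    and assoc: "\<And>x y z. x \<in> S \<Longrightarrow> y \<in> S \<Longrightarrow> z \<in> S \<Longrightarrow> f (f x y) z = f x (f y z)"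
  shows "preorder_on S (mitsch_order S f)"
proof -
  have "trans (mitsch_order S f)"
  proof (rule transI)
    fix a b c
    assume ab: "(a, b) \<in> mitsch_order S f" and bc: "(b, c) \<in> mitsch_order S f"
    then have S: "a \<in> S" "b \<in> S" "c \<in> S"
      by (auto simp: mitsch_order_def)
    show "(a, c) \<in> mitsch_order S f"
    proof (cases "a = b \<or> b = c")
      case True
      then show ?thesis using ab bc by auto
    next
      case False
      obtain x y where xy: "x \<in> S" "y \<in> S" "a = f a x" "a = f b x" "a = f y b"
        using ab False by (auto simp: mitsch_order_def)
      obtain u v where uv: "u \<in> S" "v \<in> S" "b = f b u" "b = f c u" "b = f v c"
        using bc False by (auto simp: mitsch_order_def)
      have "f a u = a"
        using xy uv S assoc by metis
      then have "a = f a (f u x)"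
        using xy uv S assoc by metis
      moreover have "a = f c (f u x)" "a = f (f y v) c"
        using xy uv S assoc by metis+
      ultimately show ?thesis
        using S xy uv closed unfolding mitsch_order_def by blast
    qed
  qed
  then show ?thesis
    by (auto simp: preorder_on_def refl_on_def mitsch_order_def)
qed

lemma preorder_on_binrel_mitsch: "preorder_on (binrels X) (binrel_mitsch X)"
  unfolding binrel_mitsch_def
  by (rule preorder_on_mitsch_order) (auto simp: binrels_def)

end

(* The empty relation is contained in every relation and lies Mitsch-below every relation,
   so any preorder containing both orders is universal. *)
theory Submission
  imports Defs
begin

text \<open>The empty relation is a zero of the semigroup, so it lies below every \<beta> in the
  Mitsch order (\<open>empty_binrel_mitsch\<close>), while every \<alpha> contains it. Hence
  \<alpha> and \<beta> are always linked through \<open>{}\<close>, and the composite is universal.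
  By transitivity the join contains the composite, so it is universal too.\<close>

lemma empty_binrel_mitsch: "\<beta> \<in> binrels X \<Longrightarrow> ({}, \<beta>) \<in> binrel_mitsch X"
  \<comment> \<open>Both multipliers can be taken to be \<open>{}\<close>.\<close>
  by (auto simp: binrel_mitsch_def mitsch_order_def binrels_def)

lemma binrel_supset_O_binrel_mitsch:
  "binrel_supset X O binrel_mitsch X = binrels X \<times> binrels X"
proof
  show "binrel_supset X O binrel_mitsch X \<subseteq> binrels X \<times> binrels X"
    by (auto simp: binrel_supset_def binrel_mitsch_def mitsch_order_def)
  have "(\<alpha>, {}) \<in> binrel_supset X" if "\<alpha> \<in> binrels X" for \<alpha>
    using that by (simp add: binrel_supset_def binrels_def)
  then show "binrels X \<times> binrels X \<subseteq> binrel_supset X O binrel_mitsch X"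
    using empty_binrel_mitsch by blast
qed

theorem proposition5p3:
  fixes X :: "'a set"
  shows "binrel_supset X O binrel_mitsch X = binrels X \<times> binrels X
    \<and> binrel_supset X O binrel_mitsch X
        = binrel_supset X \<squnion>\<^bsub>preorder_lattice (binrels X)\<^esub> binrel_mitsch X"
proof -
  let ?L = "preorder_lattice (binrels X)"
  let ?J = "binrel_supset X \<squnion>\<^bsub>?L\<^esub> binrel_mitsch X"
  interpret lattice ?L
    by (rule lattice_preorder_lattice)
  have carrier: "binrel_supset X \<in> carrier ?L" "binrel_mitsch X \<in> carrier ?L"
    by (simp_all add: preorder_lattice_def preorder_on_binrel_supset preorder_on_binrel_mitsch)
  have J: "?J \<subseteq> binrels X \<times> binrels X" "trans ?J"
    using join_closed[OF carrier] by (auto simp: preorder_lattice_def preorder_on_def)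
  have "binrel_supset X \<subseteq> ?J" "binrel_mitsch X \<subseteq> ?J"
    using join_left[OF carrier] join_right[OF carrier] by (simp_all add: preorder_lattice_def)
  then have "binrel_supset X O binrel_mitsch X \<subseteq> ?J"
    using \<open>trans ?J\<close> by (blast dest: transD)
  \<comment> \<open>The join is squeezed between the composite, already universal, and
    \<open>binrels X \<times> binrels X\<close>.\<close>
  then show ?thesis
    using J(1) binrel_supset_O_binrel_mitsch by blast
qed

end
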